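(* Let $\mathcal{A}$ be a finite alphabet. For all $m,n\ge1$ and all $X\subseteq\mathcal{A}^{\mathbb{N}}$, $$(X^{[m]})^{[n]}=(X^{[n]})^{[m]}=X^{[\mathrm{lcm}(m,n)]},$$ where $\mathrm{lcm}(m,n)$ denotes the least common multiple of $m$ and $n$.
   Context: $\mathbb{N}=\{0,1,2,\dots\}$. For $\mathbf{x}=a_0a_1a_2\cdots\in\mathcal{A}^{\mathbb{N}}$, $i\ge0$, $n\ge1$, the decimation is $\psi_{i,n}(\mathbf{x})=a_ia_{i+n}a_{i+2n}\cdots$, and $\psi_{i,n}(X)=\{\psi_{i,n}(\mathbf{x}):\mathbf{x}\in X\}$. The $n$-fold interleaving of sequences $\mathbf{x}_i=a_{i,0}a_{i,1}\cdots$ ($0\le i\le n-1$) is $b_0b_1b_2\cdots$ with $b_{i+jn}=a_{i,j}$ ($0\le i\le n-1$, $j\ge0$); the $n$-fold interleaving $(\circledast_n)_{i=0}^{n-1}X_i$ of sets is the set of all $n$-fold interleavings of $(\mathbf{x}_0,\dots,\mathbf{x}_{n-1})$ with $\mathbf{x}_i\in X_i$. The $n$-fold interleaving closure of $X$ is $X^{[n]}=(\circledast_n)_{i=0}^{n-1}\psi_{i,n}(X)$. *)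

theory Defs
  imports "HOL-Library.FuncSet"
begin

text \<open>
  One-sided infinite sequences over a set \<open>A\<close> are functions in \<open>UNIV \<rightarrow> A\<close>, with
  \<open>UNIV :: nat set\<close>.  All notions below are intended for step sizes \<open>n \<ge> 1\<close>.
\<close>

definition decimation :: "nat \<Rightarrow> nat \<Rightarrow> (nat \<Rightarrow> 'a) \<Rightarrow> (nat \<Rightarrow> 'a)" where
  "decimation i n x = (\<lambda>j. x (i + j * n))"

definition interleave :: "nat \<Rightarrow> (nat \<Rightarrow> nat \<Rightarrow> 'a) \<Rightarrow> (nat \<Rightarrow> 'a)" where
  "interleave n a = (\<lambda>k. a (k mod n) (k div n))"

lemma interleave_nth:
  assumes "i < n"
  shows "interleave n a (i + j * n) = a i j"
  using assms by (simp add: interleave_def)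

definition interleave_sets :: "nat \<Rightarrow> (nat \<Rightarrow> (nat \<Rightarrow> 'a) set) \<Rightarrow> (nat \<Rightarrow> 'a) set" where
  "interleave_sets n S = {interleave n a | a. \<forall>i<n. a i \<in> S i}"

definition interleaving_closure :: "(nat \<Rightarrow> 'a) set \<Rightarrow> nat \<Rightarrow> (nat \<Rightarrow> 'a) set" where
  "interleaving_closure X n = interleave_sets n (\<lambda>i. decimation i n ` X)"

end

theory Submission
  imports Defs "HOL-Number_Theory.Cong"
begin

text \<open>
  A sequence lies in the \<open>n\<close>-fold interleaving closure of \<open>X\<close> iff on every residue class modulo
  \<open>n\<close> it agrees with some element of \<open>X\<close>. Iterating, membership in the double closure means
  agreement with some element of \<open>X\<close> on every intersection of a class modulo \<open>m\<close> with a class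
  modulo \<open>n\<close>; such an intersection is empty or a class modulo \<open>lcm m n\<close>.
\<close>

text \<open>Letting \<open>c\<close> range over all naturals, not just \<open>c < n\<close>, costs
  nothing since only its class matters, and lets conditions for different moduli be
  combined.\<close>

lemma mem_interleaving_closure_iff:
  assumes "n \<ge> 1"
  shows "z \<in> interleaving_closure X n \<longleftrightarrow> (\<forall>c. \<exists>x\<in>X. \<forall>k. [k = c] (mod n) \<longrightarrow> z k = x k)"
proof
  assume "z \<in> interleaving_closure X n"
  then obtain a where z: "z = interleave n a" and a: "\<And>i. i < n \<Longrightarrow> a i \<in> decimation i n ` X"
    by (auto simp: interleaving_closure_def interleave_sets_def)
  show "\<forall>c. \<exists>x\<in>X. \<forall>k. [k = c] (mod n) \<longrightarrow> z k = x k"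
  proof
    fix c
    have "c mod n < n" using assms by simp
    from a[OF this] obtain x where "x \<in> X" "a (c mod n) = decimation (c mod n) n x" by auto
    moreover have "z k = x k" if "[k = c] (mod n)" for k
    proof -
      have "c mod n + k div n * n = k" using that by (metis cong_def mod_div_mult_eq)
      then show ?thesis
        using that calculation(2) by (simp add: z interleave_def decimation_def cong_def)
    qed
    ultimately show "\<exists>x\<in>X. \<forall>k. [k = c] (mod n) \<longrightarrow> z k = x k" by blast
  qed
next
  assume "\<forall>c. \<exists>x\<in>X. \<forall>k. [k = c] (mod n) \<longrightarrow> z k = x k"
  then obtain f where f: "\<And>c. f c \<in> X" "\<And>c k. [k = c] (mod n) \<Longrightarrow> z k = f c k" by metis
  \<comment> \<open>\<open>decimation i n\<close> reads only indices congruent to \<open>i\<close>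
    modulo \<open>n\<close>, where \<open>z\<close> agrees with \<open>f i\<close>.\<close>
  have "decimation i n z = decimation i n (f i)" for i
    using f(2) by (auto simp: decimation_def cong_def)
  then have "decimation i n z \<in> decimation i n ` X" for i
    using f(1) by auto
  moreover have "z = interleave n (\<lambda>i. decimation i n z)"
    by (simp add: interleave_def decimation_def)
  ultimately show "z \<in> interleaving_closure X n"
    unfolding interleaving_closure_def interleave_sets_def by blast
qed

lemma cong_lcm_iff_nat:
  fixes a b m n :: nat
  shows "[a = b] (mod lcm m n) \<longleftrightarrow> [a = b] (mod m) \<and> [a = b] (mod n)"
  by (meson cong_cong_lcm_nat cong_dvd_modulus_nat dvd_lcm1 dvd_lcm2)

lemma interleaving_closure_interleaving_closure:
  assumes "m \<ge> 1" and "n \<ge> 1"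
  shows "interleaving_closure (interleaving_closure X m) n = interleaving_closure X (lcm m n)"
proof (rule set_eqI, rule iffI)
  have lcm: "lcm m n \<ge> 1" using assms by (simp add: Suc_le_eq lcm_pos_nat)
  fix z
  {
    assume "z \<in> interleaving_closure (interleaving_closure X m) n"
    \<comment> \<open>For a class \<open>c\<close>, pick \<open>y\<close> in the inner closure
      matching \<open>z\<close> modulo \<open>n\<close>, then \<open>x\<close> in \<open>X\<close>
      matching \<open>y\<close> modulo \<open>m\<close>; on the common class \<open>z\<close>,
      \<open>y\<close> and \<open>x\<close> coincide.\<close>
    then show "z \<in> interleaving_closure X (lcm m n)"
      unfolding mem_interleaving_closure_iff[OF assms(2)] mem_interleaving_closure_iff[OF lcm]
        mem_interleaving_closure_iff[OF assms(1)] Bex_def cong_lcm_iff_nat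
      by metis
  }
  assume "z \<in> interleaving_closure X (lcm m n)"
  then have z: "\<exists>x\<in>X. \<forall>k. [k = c] (mod m) \<and> [k = c] (mod n) \<longrightarrow> z k = x k" for c
    by (simp add: mem_interleaving_closure_iff[OF lcm] cong_lcm_iff_nat)
  have "\<exists>x\<in>X. \<forall>k. [k = d] (mod m) \<and> [k = c] (mod n) \<longrightarrow> z k = x k" for c d
  proof (cases "\<exists>e. [e = d] (mod m) \<and> [e = c] (mod n)")
    case True
    \<comment> \<open>A common element \<open>e\<close> represents the whole intersection, so
      \<open>z\<close> applies with \<open>c := e\<close>.\<close>
    then show ?thesis using z by (meson cong_sym cong_trans)
  next
    case False
    \<comment> \<open>No index meets both congruences, so any element of \<open>X\<close> will do;
      \<open>z\<close> shows that one exists.\<close>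
    then show ?thesis using z by blast
  qed
  then have "\<forall>c d. \<exists>x. x \<in> X \<and> (\<forall>k. [k = d] (mod m) \<and> [k = c] (mod n) \<longrightarrow> z k = x k)"
    by blast
  then obtain f where f: "\<And>c d. f c d \<in> X"
    "\<And>c d k. [k = d] (mod m) \<Longrightarrow> [k = c] (mod n) \<Longrightarrow> z k = f c d k"
    unfolding choice_iff by blast
  \<comment> \<open>For fixed \<open>c\<close>, glue the sequences \<open>f c d\<close> along the
    classes modulo \<open>m\<close>; \<open>k mod m\<close> is a canonical representative, so a
    whole class uses the same element of \<open>X\<close>.\<close>
  define y where "y = (\<lambda>c k. f c (k mod m) k)"
  have "y c \<in> interleaving_closure X m" for c
    unfolding mem_interleaving_closure_iff[OF assms(1)] y_def cong_def using f(1) by metis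
  moreover have "z k = y c k" if "[k = c] (mod n)" for c k
    using f(2) that by (simp add: y_def)
  ultimately show "z \<in> interleaving_closure (interleaving_closure X m) n"
    unfolding mem_interleaving_closure_iff[OF assms(2)] by blast
qed

theorem theorem2p10:
  fixes A :: "'a set" and X :: "(nat \<Rightarrow> 'a) set" and m n :: nat
  assumes "finite A"
    and "m \<ge> 1" and "n \<ge> 1"
    and "X \<subseteq> UNIV \<rightarrow> A"
  shows "interleaving_closure (interleaving_closure X m) n
           = interleaving_closure (interleaving_closure X n) m
       \<and> interleaving_closure (interleaving_closure X n) m
           = interleaving_closure X (lcm m n)"
  using assms by (simp add: interleaving_closure_interleaving_closure lcm.commute)

end
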